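(* Let $R$ be a commutative ring. For any ideal $J$ of $R$, the $J$-basically empty operation $L\subseteq M\mapsto L_{J\mathrm{be}}^M:=J(L:_MJ)$ on pairs of $R$-modules is a cohereditary interior operation.
   Context: For $R$-modules $L\subseteq M$ and an ideal $J$, $(L:_MJ)=\{z\in M\mid Jz\subseteq L\}$, and the $J$-basically empty interior of $L$ in $M$ is $L_{J\mathrm{be}}^M:=J(L:_MJ)$. A (relative) interior operation assigns to each pair $L\subseteq M$ of $R$-modules a submodule $L_{\mathrm i}^M\subseteq M$, compatibly with isomorphisms of $M$, such that $L_{\mathrm i}^M\subseteq L$; $L_{\mathrm i}^M\subseteq N_{\mathrm i}^M$ for $L\subseteq N\subseteq M$; and $(L_{\mathrm i}^M)_{\mathrm i}^M=L_{\mathrm i}^M$. It is cohereditary if $(N/L)_{\mathrm i}^{M/L}=\frac{N_{\mathrm i}^M+L}{L}$ for all $L\subseteq N\subseteq M$. *)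

theory Defs
  imports "HOL-Algebra.Module" "HOL-Algebra.QuotRing"
begin

text \<open>The ring fields \<open>mult\<close> and \<open>one\<close> inherited by the record \<open>module\<close> play no role
  in the locale \<open>module\<close>, nor in any definition below.\<close>

definition module_iso ::
    "('r, 'x) ring_scheme \<Rightarrow> ('r, 'm, 'e) module_scheme \<Rightarrow> ('r, 'n, 'f) module_scheme \<Rightarrow> ('m \<Rightarrow> 'n) set"
  where "module_iso R M M' = {f \<in> iso (add_monoid M) (add_monoid M').
    \<forall>r\<in>carrier R. \<forall>x\<in>carrier M. f (r \<odot>\<^bsub>M\<^esub> x) = r \<odot>\<^bsub>M'\<^esub> f x}"

definition quotient_smult :: "('r, 'm, 'e) module_scheme \<Rightarrow> 'm set \<Rightarrow> 'r \<Rightarrow> 'm set \<Rightarrow> 'm set"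
  where "quotient_smult M L r X = (\<Union>x\<in>X. L +>\<^bsub>M\<^esub> (r \<odot>\<^bsub>M\<^esub> x))"

definition quotient_module :: "('r, 'm, 'e) module_scheme \<Rightarrow> 'm set \<Rightarrow> ('r, 'm set) module"
  where "quotient_module M L =
    \<lparr>carrier = a_rcosets\<^bsub>M\<^esub> L, mult = undefined, one = undefined,
     zero = L, add = set_add M, smult = quotient_smult M L\<rparr>"

text \<open>The submodule \<open>K/L\<close> of \<open>M/L\<close>, for \<open>L \<subseteq> K \<subseteq> M\<close>.\<close>

definition quotient_submodule :: "('r, 'm, 'e) module_scheme \<Rightarrow> 'm set \<Rightarrow> 'm set \<Rightarrow> 'm set set"
  where "quotient_submodule M L K = (\<lambda>x. L +>\<^bsub>M\<^esub> x) ` K"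

lemma quotient_smult_coset:
  assumes "module R M" "submodule L R M" "r \<in> carrier R" "x \<in> carrier M"
  shows "quotient_smult M L r (L +>\<^bsub>M\<^esub> x) = L +>\<^bsub>M\<^esub> (r \<odot>\<^bsub>M\<^esub> x)"
proof -
  interpret module R M by fact
  interpret L: submodule L R M by fact
  have L: "L \<subseteq> carrier M" "\<zero>\<^bsub>M\<^esub> \<in> L" using L.subset L.one_closed by auto
  have sub: "subgroup L (add_monoid M)" by (rule L.subgroup_axioms)
  have eq: "L +>\<^bsub>M\<^esub> (r \<odot>\<^bsub>M\<^esub> y) = L +>\<^bsub>M\<^esub> (r \<odot>\<^bsub>M\<^esub> x)" if y: "y \<in> L +>\<^bsub>M\<^esub> x" for y
  proof -
    obtain h where h: "h \<in> L" "y = h \<oplus>\<^bsub>M\<^esub> x" using y by (auto simp: a_r_coset_def')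
    then have "r \<odot>\<^bsub>M\<^esub> y = r \<odot>\<^bsub>M\<^esub> h \<oplus>\<^bsub>M\<^esub> r \<odot>\<^bsub>M\<^esub> x"
      using assms L by (auto intro: smult_r_distr)
    moreover have "r \<odot>\<^bsub>M\<^esub> h \<in> L" using h assms by simp
    ultimately have "r \<odot>\<^bsub>M\<^esub> y \<in> L +>\<^bsub>M\<^esub> (r \<odot>\<^bsub>M\<^esub> x)" by (auto simp: a_r_coset_def')
    then show ?thesis
      using a_repr_independence[OF _ _ sub] assms by (metis smult_closed)
  qed
  have "\<zero>\<^bsub>M\<^esub> \<oplus>\<^bsub>M\<^esub> x \<in> L +>\<^bsub>M\<^esub> x" using L by (auto simp: a_r_coset_def')
  then show ?thesis unfolding quotient_smult_def using eq by blast
qed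

lemma quotient_module_is_module:
  assumes "module R M" "submodule L R M"
  shows "module R (quotient_module M L)"
proof -
  interpret module R M by fact
  interpret L: submodule L R M by fact
  interpret A: abelian_subgroup L M
    by (rule abelian_subgroupI3[OF additive_subgroup.intro[OF L.subgroup_axioms]]) unfold_locales
  have L: "L \<subseteq> carrier M" by (rule A.a_subset)
  note simps = quotient_module_def A_RCOSETS_def' A.a_rcos_sum
  have ab: "abelian_group (quotient_module M L)"
  proof (rule abelian_groupI, goal_cases)
    case (6 X)
    then obtain x where x: "x \<in> carrier M" "X = L +>\<^bsub>M\<^esub> x" by (auto simp: simps)
    show ?case
      by (rule bexI[of _ "L +>\<^bsub>M\<^esub> (\<ominus>\<^bsub>M\<^esub> x)"]) (use x L in \<open>auto simp: simps M.l_neg\<close>)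
  next
    case 2
    have "L = L +>\<^bsub>M\<^esub> \<zero>\<^bsub>M\<^esub>" using L by simp
    then show ?case by (auto simp: simps)
  next
    case (5 X)
    then obtain x where x: "x \<in> carrier M" "X = L +>\<^bsub>M\<^esub> x" by (auto simp: simps)
    have "L <+>\<^bsub>M\<^esub> X = (L +>\<^bsub>M\<^esub> \<zero>\<^bsub>M\<^esub>) <+>\<^bsub>M\<^esub> (L +>\<^bsub>M\<^esub> x)" using x L by simp
    also have "\<dots> = X" using x by (subst A.a_rcos_sum) simp_all
    finally show ?case by (simp add: quotient_module_def)
  qed (auto simp: simps M.a_ac)
  show ?thesis
    by (rule moduleI[OF R.is_cring ab])
      (auto simp: quotient_module_def A_RCOSETS_def' quotient_smult_coset[OF assms] A.a_rcos_sum
        smult_l_distr smult_r_distr smult_assoc1)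
qed

text \<open>The product \<open>J N\<close>, as for ideals in \<open>HOL-Algebra.Ideal_Product\<close>: the finite nonempty sums
  of products \<open>j \<odot> z\<close>; the zero element arises from \<open>j = \<zero>\<close>.\<close>

inductive_set ideal_smult :: "('r, 'm, 'e) module_scheme \<Rightarrow> 'r set \<Rightarrow> 'm set \<Rightarrow> 'm set"
  for M and J and N where
    smult: "\<lbrakk> j \<in> J; z \<in> N \<rbrakk> \<Longrightarrow> j \<odot>\<^bsub>M\<^esub> z \<in> ideal_smult M J N"
  | sum: "\<lbrakk> s \<in> ideal_smult M J N; t \<in> ideal_smult M J N \<rbrakk> \<Longrightarrow> s \<oplus>\<^bsub>M\<^esub> t \<in> ideal_smult M J N"

definition colon :: "('r, 'm, 'e) module_scheme \<Rightarrow> 'm set \<Rightarrow> 'r set \<Rightarrow> 'm set"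
  where "colon M L J = {z \<in> carrier M. \<forall>j\<in>J. j \<odot>\<^bsub>M\<^esub> z \<in> L}"

definition basically_empty :: "'r set \<Rightarrow> ('r, 'm) module \<Rightarrow> 'm set \<Rightarrow> 'm set"
  where "basically_empty J M L = ideal_smult M J (colon M L J)"

text \<open>An operation on pairs \<open>L \<subseteq> M\<close> is rendered as a function of type
  \<open>('r, 'm) module \<Rightarrow> 'm set \<Rightarrow> 'm set\<close>, of which only the values at modules \<open>M\<close> and
  submodules \<open>L\<close> matter. Since HOL has no type of all modules, such a function is the restriction
  of an operation to the modules with elements in \<open>'m\<close>, and conditions that relate modules over
  different types take the restrictions of the operation to both types as arguments.\<close>

definition iso_compatible ::
    "('r, 'x) ring_scheme \<Rightarrow> (('r, 'm) module \<Rightarrow> 'm set \<Rightarrow> 'm set) \<Rightarrow>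
      (('r, 'n) module \<Rightarrow> 'n set \<Rightarrow> 'n set) \<Rightarrow> bool"
  where "iso_compatible R i i' \<longleftrightarrow>
    (\<forall>M M' f L. module R M \<and> module R M' \<and> f \<in> module_iso R M M' \<and> submodule L R M \<longrightarrow>
       i' M' (f ` L) = f ` i M L)"

definition interior_operation ::
    "('r, 'x) ring_scheme \<Rightarrow> (('r, 'm) module \<Rightarrow> 'm set \<Rightarrow> 'm set) \<Rightarrow> bool"
  where "interior_operation R i \<longleftrightarrow>
    (\<forall>M L. module R M \<and> submodule L R M \<longrightarrow> submodule (i M L) R M) \<and>
    iso_compatible R i i \<and>
    (\<forall>M L. module R M \<and> submodule L R M \<longrightarrow> i M L \<subseteq> L) \<and>
    (\<forall>M L N. module R M \<and> submodule L R M \<and> submodule N R M \<and> L \<subseteq> N \<longrightarrow> i M L \<subseteq> i M N) \<and>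
    (\<forall>M L. module R M \<and> submodule L R M \<longrightarrow> i M (i M L) = i M L)"

definition cohereditary ::
    "('r, 'x) ring_scheme \<Rightarrow> (('r, 'm) module \<Rightarrow> 'm set \<Rightarrow> 'm set) \<Rightarrow>
      (('r, 'm set) module \<Rightarrow> 'm set set \<Rightarrow> 'm set set) \<Rightarrow> bool"
  where "cohereditary R i i' \<longleftrightarrow>
    (\<forall>M L N. module R M \<and> submodule L R M \<and> submodule N R M \<and> L \<subseteq> N \<longrightarrow>
       i' (quotient_module M L) (quotient_submodule M L N) =
       quotient_submodule M L (i M N <+>\<^bsub>M\<^esub> L))"

end

theory Submission
  imports Defs
begin

text \<open>For fixed \<open>J\<close>, the maps N |-> J N and L |-> (L : J) form a Galois
  connection: J N \<subseteq> L iff N \<subseteq> (L : J). Their composite J (L : J) is therefore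
  contained in L, monotone and idempotent, as an interior must be. Compatibility with isomorphisms
  and the cohereditary law are two cases of one fact, \<open>basically_empty_image\<close>: a
  surjective linear map carries the interior of L to the interior of the image of L whenever L
  contains the kernel. Indeed products commute with linear images
  (\<open>ideal_smult_image\<close>), and under that condition colons do too. An isomorphism has
  zero kernel; for the projection onto M/L the lemma is applied to N, which contains the kernel
  L.\<close>

lemma ideal_smult_mono: "N \<subseteq> N' \<Longrightarrow> ideal_smult M J N \<subseteq> ideal_smult M J N'"
proof
  fix x assume "N \<subseteq> N'" "x \<in> ideal_smult M J N"
  from this(2,1) show "x \<in> ideal_smult M J N'"
    by induction (auto intro: ideal_smult.intros)
qed

lemma colon_mono: "L \<subseteq> N \<Longrightarrow> colon M L J \<subseteq> colon M N J"
  by (auto simp: colon_def)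

lemma basically_empty_mono:
  "L \<subseteq> N \<Longrightarrow> basically_empty J M L \<subseteq> basically_empty J M N"
  unfolding basically_empty_def by (intro ideal_smult_mono colon_mono)

lemma (in module) ideal_smult_carrier:
  assumes "J \<subseteq> carrier R" "N \<subseteq> carrier M"
  shows "ideal_smult M J N \<subseteq> carrier M"
proof
  fix x assume "x \<in> ideal_smult M J N"
  then show "x \<in> carrier M"
    by induction (use assms in auto)
qed

text \<open>Negation and scalars are absorbed into the coefficient of each generator, because
  \<open>J\<close> is an ideal; induction carries this over sums. Any element of the nonempty
  \<open>N\<close> supplies zero, as its multiple by the zero scalar.\<close>

lemma (in module) ideal_smult_submodule:
  assumes "ideal J R" "N \<subseteq> carrier M" "N \<noteq> {}"
  shows "submodule (ideal_smult M J N) R M"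
proof -
  interpret J: ideal J R by fact
  have J: "J \<subseteq> carrier R" by (rule J.a_subset)
  note carr = ideal_smult_carrier[OF J assms(2)]
  show ?thesis
  proof (rule submoduleI[OF carr])
    obtain z where z: "z \<in> N" using assms by auto
    have "\<zero> \<odot>\<^bsub>M\<^esub> z \<in> ideal_smult M J N"
      using z by (intro ideal_smult.smult) auto
    then show "\<zero>\<^bsub>M\<^esub> \<in> ideal_smult M J N"
      using z assms by auto
  next
    fix a assume "a \<in> ideal_smult M J N"
    then show "\<ominus>\<^bsub>M\<^esub> a \<in> ideal_smult M J N"
    proof induction
      case (smult j z)
      then have "\<ominus>\<^bsub>M\<^esub> (j \<odot>\<^bsub>M\<^esub> z) = (\<ominus> j) \<odot>\<^bsub>M\<^esub> z"
        using J assms(2) by (simp add: smult_l_minus subset_iff)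
      then show ?case
        using smult by (auto intro: ideal_smult.smult)
    next
      case (sum s t)
      then have "\<ominus>\<^bsub>M\<^esub> (s \<oplus>\<^bsub>M\<^esub> t) = \<ominus>\<^bsub>M\<^esub> s \<oplus>\<^bsub>M\<^esub> \<ominus>\<^bsub>M\<^esub> t"
        using carr by (simp add: M.minus_add subset_iff)
      then show ?case
        using sum by (auto intro: ideal_smult.sum)
    qed
  next
    fix a b assume "a \<in> ideal_smult M J N" "b \<in> ideal_smult M J N"
    then show "a \<oplus>\<^bsub>M\<^esub> b \<in> ideal_smult M J N" by (rule ideal_smult.sum)
  next
    fix r x assume r: "r \<in> carrier R" and "x \<in> ideal_smult M J N"
    from this(2) show "r \<odot>\<^bsub>M\<^esub> x \<in> ideal_smult M J N"
    proof induction
      case (smult j z)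
      then have "r \<odot>\<^bsub>M\<^esub> (j \<odot>\<^bsub>M\<^esub> z) = (r \<otimes> j) \<odot>\<^bsub>M\<^esub> z"
        using J assms(2) r by (simp add: smult_assoc1 subset_iff)
      then show ?case
        using smult r by (auto intro: ideal_smult.smult J.I_l_closed)
    next
      case (sum s t)
      then have "r \<odot>\<^bsub>M\<^esub> (s \<oplus>\<^bsub>M\<^esub> t) = r \<odot>\<^bsub>M\<^esub> s \<oplus>\<^bsub>M\<^esub> r \<odot>\<^bsub>M\<^esub> t"
        using carr r by (simp add: smult_r_distr subset_iff)
      then show ?case
        using sum by (auto intro: ideal_smult.sum)
    qed
  qed
qed

text \<open>The colon contains zero, so it is a nonempty subset of the carrier, to which
  \<open>ideal_smult_submodule\<close> applies.\<close>

lemma basically_empty_submodule: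
  assumes "module R M" "submodule L R M" "ideal J R"
  shows "submodule (basically_empty J M L) R M"
proof -
  interpret module R M by fact
  interpret L: submodule L R M by fact
  have "\<zero>\<^bsub>M\<^esub> \<in> colon M L J"
    using L.one_closed ideal.Icarr[OF assms(3)] by (auto simp: colon_def)
  then show ?thesis
    unfolding basically_empty_def
    by (intro ideal_smult_submodule assms) (auto simp: colon_def)
qed

lemma basically_empty_subset:
  assumes "submodule L R M"
  shows "basically_empty J M L \<subseteq> L"
proof
  interpret L: submodule L R M by fact
  fix x assume "x \<in> basically_empty J M L"
  then have "x \<in> ideal_smult M J (colon M L J)"
    by (simp add: basically_empty_def)
  then show "x \<in> L"
    by induction (use L.m_closed in \<open>auto simp: colon_def\<close>)
qed

lemma basically_empty_idem:
  assumes "module R M" "submodule L R M" "ideal J R"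
  shows "basically_empty J M (basically_empty J M L) = basically_empty J M L"
proof (rule antisym)
  show "basically_empty J M (basically_empty J M L) \<subseteq> basically_empty J M L"
    using basically_empty_subset[OF basically_empty_submodule[OF assms]] .
  \<comment> \<open>The unit of the Galois connection: for \<open>z\<close> in the colon every
    product of some \<open>j\<close> in \<open>J\<close> with \<open>z\<close> is a generator of J
    (L : J), so \<open>z\<close> also lies in the colon of that smaller submodule.\<close>
  have "colon M L J \<subseteq> colon M (ideal_smult M J (colon M L J)) J"
    by (auto simp: colon_def intro!: ideal_smult.smult)
  then show "basically_empty J M L \<subseteq> basically_empty J M (basically_empty J M L)"
    unfolding basically_empty_def by (rule ideal_smult_mono)
qed

text \<open>A linear map takes generators to generators and sums to sums, so each inclusion is an
  induction on the product. The equations for \<open>f\<close> hold on the carrier, hence the appeal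
  to \<open>carr\<close> for partial sums.\<close>

lemma (in module) ideal_smult_image:
  assumes "J \<subseteq> carrier R" "N \<subseteq> carrier M"
    and add: "\<And>x y. x \<in> carrier M \<Longrightarrow> y \<in> carrier M \<Longrightarrow> f (x \<oplus>\<^bsub>M\<^esub> y) = f x \<oplus>\<^bsub>M'\<^esub> f y"
    and smult: "\<And>r x. r \<in> carrier R \<Longrightarrow> x \<in> carrier M \<Longrightarrow> f (r \<odot>\<^bsub>M\<^esub> x) = r \<odot>\<^bsub>M'\<^esub> f x"
  shows "ideal_smult M' J (f ` N) = f ` ideal_smult M J N"
proof (intro equalityI subsetI)
  note carr = ideal_smult_carrier[OF assms(1,2)]
  fix y assume "y \<in> ideal_smult M' J (f ` N)"
  then show "y \<in> f ` ideal_smult M J N"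
  proof induction
    case (smult j z)
    then obtain x where x: "x \<in> N" "z = f x" by auto
    then have "j \<odot>\<^bsub>M'\<^esub> z = f (j \<odot>\<^bsub>M\<^esub> x)"
      using assms(1,2) smult by (simp add: assms(4) subset_iff)
    then show ?case
      using smult x by (auto intro: ideal_smult.smult)
  next
    case (sum s t)
    then obtain u v where uv: "u \<in> ideal_smult M J N" "s = f u" "v \<in> ideal_smult M J N" "t = f v"
      by auto
    then have "s \<oplus>\<^bsub>M'\<^esub> t = f (u \<oplus>\<^bsub>M\<^esub> v)"
      using carr by (simp add: add subset_iff)
    then show ?case
      using uv by (auto intro: ideal_smult.sum)
  qed
next
  note carr = ideal_smult_carrier[OF assms(1,2)]
  fix y assume "y \<in> f ` ideal_smult M J N"
  then obtain x where "x \<in> ideal_smult M J N" and y: "y = f x" by auto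
  from this(1) have "f x \<in> ideal_smult M' J (f ` N)"
  proof induction
    case (smult j z)
    then have "f (j \<odot>\<^bsub>M\<^esub> z) = j \<odot>\<^bsub>M'\<^esub> f z"
      using assms(1,2) by (simp add: assms(4) subset_iff)
    then show ?case
      using smult by (auto intro: ideal_smult.smult)
  next
    case (sum s t)
    then have "f (s \<oplus>\<^bsub>M\<^esub> t) = f s \<oplus>\<^bsub>M'\<^esub> f t"
      using carr by (simp add: add subset_iff)
    then show ?case
      using sum by (auto intro: ideal_smult.sum)
  qed
  then show "y \<in> ideal_smult M' J (f ` N)" using y by simp
qed

text \<open>The last assumption says that \<open>L\<close> contains the kernel of \<open>f\<close>, so this covers both
  isomorphisms and projections onto quotients.\<close>

lemma basically_empty_image:
  assumes "module R M" and "J \<subseteq> carrier R"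
    and add: "\<And>x y. x \<in> carrier M \<Longrightarrow> y \<in> carrier M \<Longrightarrow> f (x \<oplus>\<^bsub>M\<^esub> y) = f x \<oplus>\<^bsub>M'\<^esub> f y"
    and smult: "\<And>r x. r \<in> carrier R \<Longrightarrow> x \<in> carrier M \<Longrightarrow> f (r \<odot>\<^bsub>M\<^esub> x) = r \<odot>\<^bsub>M'\<^esub> f x"
    and surj: "f ` carrier M = carrier M'"
    and saturated: "\<And>x. x \<in> carrier M \<Longrightarrow> f x \<in> f ` L \<Longrightarrow> x \<in> L"
  shows "basically_empty J M' (f ` L) = f ` basically_empty J M L"
proof -
  interpret module R M by fact
  \<comment> \<open>From left to right this is saturation, applied to \<open>j\<close> times
    \<open>x\<close>. Together with surjectivity it makes the colon commute with
    \<open>f\<close>.\<close>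
  have "j \<odot>\<^bsub>M'\<^esub> f x \<in> f ` L \<longleftrightarrow> j \<odot>\<^bsub>M\<^esub> x \<in> L" if "j \<in> J" "x \<in> carrier M" for j x
    using that assms(2) saturated[of "j \<odot>\<^bsub>M\<^esub> x"]
    by (auto simp: subset_iff smult[symmetric])
  then have "colon M' (f ` L) J = f ` colon M L J"
    unfolding colon_def surj[symmetric] by auto
  then show ?thesis
    unfolding basically_empty_def
    by (simp add: ideal_smult_image[OF assms(2) _ add smult] colon_def)
qed

lemma basically_empty_iso_compatible:
  fixes R :: "('r, 'x) ring_scheme"
  assumes "ideal J R"
  shows "iso_compatible R (basically_empty J) (basically_empty J)"
  unfolding iso_compatible_def
proof (intro allI impI, elim conjE)
  fix M :: "('r, 'm) module" and M' :: "('r, 'n) module" and f L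
  assume M: "module R M" and f: "f \<in> module_iso R M M'" and L: "submodule L R M"
  interpret module R M by fact
  interpret L: submodule L R M by fact
  have bij: "bij_betw f (carrier M) (carrier M')"
    using f by (auto simp: module_iso_def iso_def)
  show "basically_empty J M' (f ` L) = f ` basically_empty J M L"
  proof (rule basically_empty_image[OF M])
    show "J \<subseteq> carrier R" using ideal.Icarr[OF assms] by auto
    show "f ` carrier M = carrier M'" using bij by (simp add: bij_betw_def)
    \<comment> \<open>Saturation comes from injectivity: an element of \<open>L\<close> with the
      same image as \<open>x\<close> equals \<open>x\<close>.\<close>
    show "x \<in> L" if "x \<in> carrier M" "f x \<in> f ` L" for x
      using that bij L.subset by (auto simp: bij_betw_def inj_on_def)
  qed (use f in \<open>auto simp: module_iso_def iso_def hom_def\<close>)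
qed

text \<open>The projection onto M/L is linear and surjective, and N is saturated for it, so
  \<open>basically_empty_image\<close> yields the image of the interior \<open>B\<close> of N.
  Although \<open>B\<close> need not contain L, adding L to it leaves the set of cosets
  unchanged.\<close>

lemma basically_empty_cohereditary:
  fixes R :: "('r, 'x) ring_scheme"
  assumes "ideal J R"
  shows "cohereditary R (basically_empty J) (basically_empty J)"
  unfolding cohereditary_def
proof (intro allI impI, elim conjE)
  fix M :: "('r, 'm) module" and L N
  assume M: "module R M" and L: "submodule L R M" and N: "submodule N R M" and LN: "L \<subseteq> N"
  interpret module R M by fact
  interpret L: submodule L R M by fact
  interpret N: submodule N R M by fact
  interpret A: abelian_subgroup L M
    by (rule abelian_subgroupI3[OF additive_subgroup.intro[OF L.subgroup_axioms]]) unfold_locales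
  define B where "B = basically_empty J M N"
  have B: "B \<subseteq> carrier M"
    using basically_empty_subset[OF N] N.subset by (auto simp: B_def)
  have "basically_empty J (quotient_module M L) ((\<lambda>x. L +>\<^bsub>M\<^esub> x) ` N) = (\<lambda>x. L +>\<^bsub>M\<^esub> x) ` B"
    unfolding B_def
  proof (rule basically_empty_image[OF M])
    show "J \<subseteq> carrier R" using ideal.Icarr[OF assms] by auto
    show "(\<lambda>x. L +>\<^bsub>M\<^esub> x) ` carrier M = carrier (quotient_module M L)"
      by (auto simp: quotient_module_def A_RCOSETS_def')
    show "x \<in> N" if x: "x \<in> carrier M" and coset: "L +>\<^bsub>M\<^esub> x \<in> (\<lambda>x. L +>\<^bsub>M\<^esub> x) ` N" for x
    proof -
      obtain n where n: "n \<in> N" "L +>\<^bsub>M\<^esub> x = L +>\<^bsub>M\<^esub> n" using coset by auto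
      \<comment> \<open>Equal cosets make \<open>x\<close> differ from \<open>n\<close> by an
        element of \<open>L\<close>, which lies in \<open>N\<close> by \<open>LN\<close>.\<close>
      have "x \<in> L +>\<^bsub>M\<^esub> n" using A.a_rcos_self[OF x] n by simp
      then obtain l where "l \<in> L" "x = l \<oplus>\<^bsub>M\<^esub> n" by (auto simp: a_r_coset_def')
      then show ?thesis using n LN N.m_closed by auto
    qed
  qed (simp_all add: quotient_module_def A.a_rcos_sum quotient_smult_coset[OF M L])
  moreover have "(\<lambda>x. L +>\<^bsub>M\<^esub> x) ` (B <+>\<^bsub>M\<^esub> L) = (\<lambda>x. L +>\<^bsub>M\<^esub> x) ` B"
  proof (intro equalityI subsetI)
    fix X assume "X \<in> (\<lambda>x. L +>\<^bsub>M\<^esub> x) ` (B <+>\<^bsub>M\<^esub> L)"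
    then obtain b l where bl: "b \<in> B" "l \<in> L" "X = L +>\<^bsub>M\<^esub> (b \<oplus>\<^bsub>M\<^esub> l)"
      by (auto simp: set_add_def')
    have carr: "b \<in> carrier M" "l \<in> carrier M" using bl B L.subset by auto
    have "b \<oplus>\<^bsub>M\<^esub> l \<in> L +>\<^bsub>M\<^esub> b"
      using bl(2) M.a_comm[OF carr] by (auto simp: a_r_coset_def')
    then have "X = L +>\<^bsub>M\<^esub> b"
      using A.a_repr_independence'[OF _ carr(1)] bl by simp
    then show "X \<in> (\<lambda>x. L +>\<^bsub>M\<^esub> x) ` B" using bl by auto
  next
    fix X assume "X \<in> (\<lambda>x. L +>\<^bsub>M\<^esub> x) ` B"
    then obtain b where b: "b \<in> B" "X = L +>\<^bsub>M\<^esub> b" by auto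
    have "b = b \<oplus>\<^bsub>M\<^esub> \<zero>\<^bsub>M\<^esub>" using b B by auto
    moreover have "\<zero>\<^bsub>M\<^esub> \<in> L" using L.one_closed by simp
    ultimately have "b \<in> B <+>\<^bsub>M\<^esub> L" using b by (subst set_add_def') blast
    then show "X \<in> (\<lambda>x. L +>\<^bsub>M\<^esub> x) ` (B <+>\<^bsub>M\<^esub> L)" using b by auto
  qed
  ultimately show "basically_empty J (quotient_module M L) (quotient_submodule M L N) =
      quotient_submodule M L (basically_empty J M N <+>\<^bsub>M\<^esub> L)"
    by (simp add: quotient_submodule_def B_def)
qed

text \<open>One instance of \<open>interior_operation\<close> sees modules over a single type, so
  compatibility with isomorphisms is stated again across two types; quotients have cosets as
  elements, whence the instance over \<open>'m set\<close> in the last conjunct.\<close>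

theorem proposition7p12:
  fixes R :: "('r, 'x) ring_scheme" and J :: "'r set"
  assumes "cring R" and "ideal J R"
  shows "interior_operation R (basically_empty J :: ('r, 'm) module \<Rightarrow> 'm set \<Rightarrow> 'm set)
    \<and> iso_compatible R (basically_empty J :: ('r, 'm) module \<Rightarrow> 'm set \<Rightarrow> 'm set)
        (basically_empty J :: ('r, 'n) module \<Rightarrow> 'n set \<Rightarrow> 'n set)
    \<and> cohereditary R (basically_empty J :: ('r, 'm) module \<Rightarrow> 'm set \<Rightarrow> 'm set)
        (basically_empty J)"
proof (intro conjI)
  show "interior_operation R (basically_empty J :: ('r, 'm) module \<Rightarrow> 'm set \<Rightarrow> 'm set)"
    unfolding interior_operation_def
    by (intro conjI allI impI)
      (simp_all add: basically_empty_submodule[OF _ _ assms(2)] basically_empty_mono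
        basically_empty_subset[where R = R]
        basically_empty_idem[OF _ _ assms(2)]
        basically_empty_iso_compatible[OF assms(2)])
qed (use assms(2) in \<open>auto intro: basically_empty_iso_compatible basically_empty_cohereditary\<close>)

end
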